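(* Let $m,b$ be positive integers and $\rho\ge 1$. Suppose a first-stage algorithm for speed-robust scheduling, on every input (number of machines $m$, number of bags $b$, jobs with processing times $p_1,\dots,p_n\ge 0$, $P=\sum_{j=1}^n p_j$), produces bags whose sizes, listed in non-increasing order $a_1\ge a_2\ge\cdots\ge a_b$, satisfy $$a_k \le \frac{\rho P-\sum_{j=1}^{k-1}a_j}{m}\qquad\text{for all }k=1,\dots,b.$$ Then the algorithm is $\rho$-robust.
   Context: Speed-robust scheduling: In the first stage, an algorithm receives positive integers $n,m,b$ and processing times $p_1,\dots,p_n\ge 0$ of $n$ jobs, and partitions the jobs into $b$ (possibly empty) bags; the size $a_i$ of bag $i$ is the sum of the processing times of the jobs in it. In the second stage, machine speeds $s_1,\dots,s_m\ge 0$ (not all zero) are revealed and each bag is assigned, as a whole, to one of the $m$ machines; a machine of speed $0$ receives no bags. Machine $i$ with assigned bag set $M_i$ has completion time $C_i=(\sum_{j\in M_i}a_j)/s_i$ (and $C_i=0$ if $s_i=0$), and the makespan is $C_{\max}=\max_i C_i$. Let $C^*_{\max}$ be the optimal makespan of scheduling the jobs directly (each job assigned as a whole to one machine) on machines with speeds $s_1,\dots,s_m$. A first-stage algorithm is $\rho$-robust if for every input and every choice of speeds there is an assignment of its bags to machines with $C_{\max}\le\rho\, C^*_{\max}$. *)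

theory Defs
  imports Complex_Main "HOL-Library.FuncSet"
begin

text \<open>Jobs, bags and machines are numbered from 0. The processing times of the jobs are given as
  a list; its length is the number of jobs. A first-stage algorithm receives the number of machines,
  the number of bags and the processing times, and returns the map sending each job to its bag.\<close>

type_synonym first_stage = "nat \<Rightarrow> nat \<Rightarrow> real list \<Rightarrow> (nat \<Rightarrow> nat)"

definition valid_jobs :: "real list \<Rightarrow> bool" where
  "valid_jobs p \<longleftrightarrow> p \<noteq> [] \<and> (\<forall>x \<in> set p. 0 \<le> x)"

definition valid_speeds :: "nat \<Rightarrow> (nat \<Rightarrow> real) \<Rightarrow> bool" where
  "valid_speeds m s \<longleftrightarrow> (\<forall>i<m. 0 \<le> s i) \<and> (\<exists>i<m. s i \<noteq> 0)"

definition first_stage_algorithm :: "first_stage \<Rightarrow> bool" where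
  "first_stage_algorithm A \<longleftrightarrow>
     (\<forall>m b p. 0 < m \<longrightarrow> 0 < b \<longrightarrow> valid_jobs p \<longrightarrow> (\<forall>j<length p. A m b p j < b))"

definition bag_size :: "real list \<Rightarrow> (nat \<Rightarrow> nat) \<Rightarrow> nat \<Rightarrow> real" where
  "bag_size p B i = (\<Sum>j | j < length p \<and> B j = i. p ! j)"

definition sorted_bag_sizes :: "nat \<Rightarrow> real list \<Rightarrow> (nat \<Rightarrow> nat) \<Rightarrow> real list" where
  "sorted_bag_sizes b p B = rev (sort (map (bag_size p B) [0..<b]))"

text \<open>The following three notions concern \<open>N\<close> indivisible items with sizes \<open>a 0, \<dots>, a (N - 1)\<close>. They
  are used both with bags and with single jobs as items. Assignments are extensional functions, so
  that there are only finitely many of them.\<close>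

definition assignments :: "nat \<Rightarrow> nat \<Rightarrow> (nat \<Rightarrow> real) \<Rightarrow> (nat \<Rightarrow> nat) set" where
  "assignments N m s = {..<N} \<rightarrow>\<^sub>E {i. i < m \<and> s i \<noteq> 0}"

definition completion_time ::
    "nat \<Rightarrow> (nat \<Rightarrow> real) \<Rightarrow> (nat \<Rightarrow> real) \<Rightarrow> (nat \<Rightarrow> nat) \<Rightarrow> nat \<Rightarrow> real" where
  "completion_time N a s f i =
     (if s i = 0 then 0 else (\<Sum>j | j < N \<and> f j = i. a j) / s i)"

definition makespan ::
    "nat \<Rightarrow> (nat \<Rightarrow> real) \<Rightarrow> nat \<Rightarrow> (nat \<Rightarrow> real) \<Rightarrow> (nat \<Rightarrow> nat) \<Rightarrow> real" where
  "makespan N a m s f = Max (completion_time N a s f ` {..<m})"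

definition opt_makespan :: "real list \<Rightarrow> nat \<Rightarrow> (nat \<Rightarrow> real) \<Rightarrow> real" where
  "opt_makespan p m s =
     Min (makespan (length p) (\<lambda>j. p ! j) m s ` assignments (length p) m s)"

text \<open>Robustness on all inputs with the given numbers of machines and bags.\<close>

definition robust :: "nat \<Rightarrow> nat \<Rightarrow> real \<Rightarrow> first_stage \<Rightarrow> bool" where
  "robust m b \<rho> A \<longleftrightarrow>
     (\<forall>p s. valid_jobs p \<longrightarrow> valid_speeds m s \<longrightarrow>
        (\<exists>f \<in> assignments b m s.
           makespan b (bag_size p (A m b p)) m s f \<le> \<rho> * opt_makespan p m s))"

end

theory Submission
  imports Defs
begin

text \<open>Give machine \<open>i\<close> the capacity \<open>\<rho> * C * s i\<close>, where \<open>C\<close> is the optimal makespan, and place the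
  bags greedily from the largest to the smallest. The optimal schedule shows that the capacities sum
  to at least \<open>\<rho> * P\<close>, so the hypothesis on the bag sizes says that each bag is at most the average
  remaining capacity of the machines. Hence some machine still has room for it.\<close>

text \<open>The condition on \<open>xs ! k\<close> mentions only the items before it, so it passes
  to prefixes of \<open>xs\<close>, and induction from the right places the items in list
  order.\<close>

lemma greedy_assignment:
  fixes a :: "'a \<Rightarrow> real" and c :: "'b \<Rightarrow> real"
  assumes I: "finite I" "I \<noteq> {}"
    and c: "\<And>i. i \<in> I \<Longrightarrow> 0 \<le> c i"
    and "distinct xs"
    and "\<And>k. k < length xs \<Longrightarrow>
           real (card I) * a (xs ! k) \<le> sum c I - (\<Sum>j<k. a (xs ! j))"
  shows "\<exists>f \<in> set xs \<rightarrow> I. \<forall>i\<in>I. (\<Sum>x | x \<in> set xs \<and> f x = i. a x) \<le> c i"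
  using assms(4,5)
proof (induction xs rule: rev_induct)
  case Nil
  then show ?case using c by auto
next
  case (snoc y xs)
  have "real (card I) * a (xs ! k) \<le> sum c I - (\<Sum>j<k. a (xs ! j))"
    if "k < length xs" for k
    using snoc.prems(2)[of k] that by (simp add: nth_append)
  then obtain f where f: "f \<in> set xs \<rightarrow> I"
    and load: "\<forall>i\<in>I. (\<Sum>x | x \<in> set xs \<and> f x = i. a x) \<le> c i"
    using snoc by auto
  have "(\<Sum>i\<in>I. \<Sum>x | x \<in> set xs \<and> f x = i. a x) = (\<Sum>x\<in>set xs. a x)"
    using f I by (intro sum.group) auto
  also have "\<dots> = (\<Sum>j<length xs. a (xs ! j))"
    using snoc.prems(1) by (simp add: sum.distinct_set_conv_list sum_list_sum_nth atLeast0LessThan)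
  finally have total: "(\<Sum>i\<in>I. \<Sum>x | x \<in> set xs \<and> f x = i. a x) = (\<Sum>j<length xs. a (xs ! j))" .
  \<comment> \<open>If \<open>y\<close> overfilled every \<open>i\<close>, summing over the nonempty
    set \<open>I\<close> would give \<open>sum c I < card I * a y\<close> plus the total already
    placed, against the hypothesis at \<open>k = length xs\<close>.\<close>
  have "\<exists>i\<in>I. a y + (\<Sum>x | x \<in> set xs \<and> f x = i. a x) \<le> c i"
  proof (rule ccontr)
    assume "\<not> ?thesis"
    then have "sum c I < (\<Sum>i\<in>I. a y + (\<Sum>x | x \<in> set xs \<and> f x = i. a x))"
      using I by (intro sum_strict_mono) auto
    then show False
      using snoc.prems(2)[of "length xs"] total by (simp add: sum.distrib nth_append)
  qed
  then obtain i where i: "i \<in> I" "a y + (\<Sum>x | x \<in> set xs \<and> f x = i. a x) \<le> c i"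
    by blast
  let ?f = "f(y := i)"
  have y: "y \<notin> set xs"
    using snoc.prems(1) by simp
  have "(\<Sum>x | x \<in> set (xs @ [y]) \<and> ?f x = j. a x) \<le> c j" if j: "j \<in> I" for j
  proof (cases "j = i")
    case True
    have "{x. x \<in> set (xs @ [y]) \<and> ?f x = i} = insert y {x. x \<in> set xs \<and> f x = i}"
      using y by auto
    then show ?thesis
      using i y True by simp
  next
    case False
    have "{x. x \<in> set (xs @ [y]) \<and> ?f x = j} = {x. x \<in> set xs \<and> f x = j}"
      using y False by auto
    then show ?thesis
      using load j by simp
  qed
  moreover have "?f \<in> set (xs @ [y]) \<rightarrow> I"
    using f i by auto
  ultimately show ?case
    by blast
qed

text \<open>Insertion commutes with \<open>map\<close>. This lets a sorted list of sizes be read as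
  the sizes along a sorted list of bags, where bags of equal size stay distinct.\<close>

lemma sort_map_eq: "sort (map f xs) = map f (sort_key f xs)"
proof -
  have "insort (f x) (map f ys) = map f (insort_key f x ys)" for x ys
    by (induction ys) auto
  then show ?thesis
    by (induction xs) auto
qed

lemma completion_time_le_makespan:
  "i < m \<Longrightarrow> completion_time N a s f i \<le> makespan N a m s f"
  by (simp add: makespan_def)

text \<open>The minimum ranges over a finite set, which is nonempty because some speed is
  nonzero.\<close>

lemma opt_makespan_attained:
  assumes "valid_speeds m s"
  obtains g where "g \<in> assignments (length p) m s"
    "opt_makespan p m s = makespan (length p) (\<lambda>j. p ! j) m s g"
proof -
  have "finite {i. i < m \<and> s i \<noteq> 0}"
    by simp
  then have "finite (assignments (length p) m s)"
    unfolding assignments_def by (intro finite_PiE) auto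
  moreover have "assignments (length p) m s \<noteq> {}"
    using assms by (auto simp: assignments_def PiE_eq_empty_iff valid_speeds_def)
  ultimately have "opt_makespan p m s
      \<in> makespan (length p) (\<lambda>j. p ! j) m s ` assignments (length p) m s"
    unfolding opt_makespan_def by (intro Min_in) auto
  then show thesis
    using that by blast
qed

text \<open>In an optimal schedule a machine of nonzero speed \<open>s i\<close> processes at most
  \<open>opt_makespan p m s * s i\<close> work, and these machines together process all
  jobs.\<close>

lemma
  assumes p: "valid_jobs p" and s: "valid_speeds m s"
  shows opt_makespan_nonneg: "0 \<le> opt_makespan p m s"
    and sum_list_le_opt_makespan:
      "sum_list p \<le> opt_makespan p m s * (\<Sum>i | i < m \<and> s i \<noteq> 0. s i)"
proof -
  let ?I = "{i. i < m \<and> s i \<noteq> 0}"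
  obtain g where g: "g \<in> assignments (length p) m s"
    and C: "opt_makespan p m s = makespan (length p) (\<lambda>j. p ! j) m s g"
    by (rule opt_makespan_attained[OF s])
  have load: "(\<Sum>j | j < length p \<and> g j = i. p ! j) / s i \<le> opt_makespan p m s" "0 < s i"
    if "i \<in> ?I" for i
    using that s completion_time_le_makespan[of i m "length p" "\<lambda>j. p ! j" s g]
    by (auto simp: C completion_time_def valid_speeds_def order_less_le)
  obtain i where "i \<in> ?I"
    using s by (auto simp: valid_speeds_def)
  moreover have "0 \<le> (\<Sum>j | j < length p \<and> g j = i. p ! j)"
    using p by (intro sum_nonneg) (auto simp: valid_jobs_def)
  ultimately show "0 \<le> opt_makespan p m s"
    using load[of i] by (meson divide_nonneg_pos order_trans)
  have "sum_list p = (\<Sum>j\<in>{..<length p}. p ! j)"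
    by (simp add: sum_list_sum_nth atLeast0LessThan)
  also have "\<dots> = (\<Sum>i\<in>?I. \<Sum>j | j \<in> {..<length p} \<and> g j = i. p ! j)"
    using g by (intro sum.group[symmetric]) (auto simp: assignments_def PiE_iff)
  also have "\<dots> \<le> (\<Sum>i\<in>?I. opt_makespan p m s * s i)"
    using load by (intro sum_mono) (simp add: pos_divide_le_eq)
  finally show "sum_list p \<le> opt_makespan p m s * (\<Sum>i\<in>?I. s i)"
    by (simp add: sum_distrib_left)
qed

theorem theorem1:
  fixes m b :: nat and \<rho> :: real and A :: first_stage
  assumes "m > 0" and "b > 0" and "\<rho> \<ge> 1"
    and "first_stage_algorithm A"
    and "\<And>p k. valid_jobs p \<Longrightarrow> k < b \<Longrightarrow>
           sorted_bag_sizes b p (A m b p) ! k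
             \<le> (\<rho> * sum_list p - (\<Sum>j<k. sorted_bag_sizes b p (A m b p) ! j)) / real m"
  shows "robust m b \<rho> A"
  unfolding robust_def
proof (intro allI impI)
  fix p s
  assume p: "valid_jobs p" and s: "valid_speeds m s"
  let ?C = "opt_makespan p m s"
  let ?I = "{i. i < m \<and> s i \<noteq> 0}"
  let ?a = "bag_size p (A m b p)"
  \<comment> \<open>The bags themselves, by non-increasing size: the order in which they are
    placed.\<close>
  define xs where "xs = rev (sort_key ?a [0..<b])"
  have len: "length xs = b" and set: "set xs = {..<b}" and dist: "distinct xs"
    by (auto simp: xs_def)
  have sizes: "sorted_bag_sizes b p (A m b p) = map ?a xs"
    by (simp add: sorted_bag_sizes_def sort_map_eq xs_def rev_map)
  have s_nonneg: "0 \<le> s i" if "i < m" for i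
    using s that by (simp add: valid_speeds_def)
  have C_nonneg: "0 \<le> \<rho> * ?C"
    using opt_makespan_nonneg[OF p s] \<open>\<rho> \<ge> 1\<close> by simp
  have capacity: "\<rho> * sum_list p \<le> (\<Sum>i\<in>?I. \<rho> * ?C * s i)"
    using mult_left_mono[OF sum_list_le_opt_makespan[OF p s], of \<rho>] \<open>\<rho> \<ge> 1\<close>
    by (simp add: sum_distrib_left mult.assoc)
  have card: "card ?I \<le> m"
    using card_mono[of "{..<m}" ?I] by auto
  \<comment> \<open>The assumption averages over all \<open>m\<close> machines, but only those in
    \<open>?I\<close> can receive bags. Since sizes are nonnegative and
    \<open>card ?I \<le> m\<close>, the bound carries over.\<close>
  have "real (card ?I) * ?a (xs ! k) \<le> (\<Sum>i\<in>?I. \<rho> * ?C * s i) - (\<Sum>j<k. ?a (xs ! j))"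
    if k: "k < length xs" for k
  proof -
    have "0 \<le> ?a (xs ! k)"
      unfolding bag_size_def using p by (intro sum_nonneg) (auto simp: valid_jobs_def)
    then have "real (card ?I) * ?a (xs ! k) \<le> real m * ?a (xs ! k)"
      using card by (intro mult_right_mono) auto
    also have "\<dots> \<le> \<rho> * sum_list p - (\<Sum>j<k. ?a (xs ! j))"
      using assms(5)[OF p, of k] k len \<open>m > 0\<close>
      by (simp add: sizes pos_le_divide_eq mult.commute)
    finally show ?thesis
      using capacity by linarith
  qed
  moreover have "?I \<noteq> {}"
    using s by (auto simp: valid_speeds_def)
  ultimately obtain f where f: "f \<in> set xs \<rightarrow> ?I"
    and load: "\<forall>i\<in>?I. (\<Sum>x | x \<in> set xs \<and> f x = i. ?a x) \<le> \<rho> * ?C * s i"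
    using greedy_assignment[of ?I "\<lambda>i. \<rho> * ?C * s i" xs ?a] C_nonneg s_nonneg dist by auto
  \<comment> \<open>Members of \<open>assignments\<close> are extensional, so \<open>f\<close> is
    cut down to the bag indices.\<close>
  let ?f = "restrict f {..<b}"
  have "?f \<in> assignments b m s"
    using f by (auto simp: assignments_def set)
  moreover have "completion_time b ?a s ?f i \<le> \<rho> * ?C" if i: "i < m" for i
  \<comment> \<open>A machine of speed 0 has completion time 0 by convention; there the bound is
    just \<open>C_nonneg\<close>.\<close>
  proof (cases "s i = 0")
    case True
    then show ?thesis using C_nonneg by (simp add: completion_time_def)
  next
    case False
    have "{j. j < b \<and> ?f j = i} = {x. x \<in> set xs \<and> f x = i}"
      by (auto simp: set)
    moreover have "0 < s i"
      using s_nonneg[OF i] False by simp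
    ultimately show ?thesis
      using load i False by (simp add: completion_time_def pos_divide_le_eq)
  qed
  then have "makespan b ?a m s ?f \<le> \<rho> * ?C"
    using \<open>m > 0\<close> unfolding makespan_def by (subst Max_le_iff) auto
  ultimately show "\<exists>f\<in>assignments b m s. makespan b ?a m s f \<le> \<rho> * ?C"
    by blast
qed

end
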